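(* Let $K$ be a field of characteristic zero, let $D$ be a digroup and let $K[D]$ be its digroup algebra. Then the rack associated with $K[D]$ by the adjoint construction coincides, on group-like elements, with the conjugation rack of $D$. More precisely, for all $x,y\in D$, $$x\triangleright y=\sum_{(x)}(x_{(1)}\vdash y)\dashv S(x_{(2)})=(x\vdash y)\dashv x^{-1}.$$ Consequently, the factorization of the rack functor $A\mapsto\mathrm{Slike}(\mathrm{Adj}(A))$ through $\mathrm{Glike}$ and $\mathrm{Conj}$ recovers the original digroup and its conjugation rack: $$K[D]\longmapsto\mathrm{Glike}(K[D])=D\longmapsto\mathrm{Conj}(D).$$
   Context: A generalized digroup is a nonempty set $D$ with two associative binary operations $\vdash,\dashv$ satisfying $x\vdash(y\dashv z)=(x\vdash y)\dashv z$, $x\dashv(y\dashv z)=x\dashv(y\vdash z)$, $(x\vdash y)\vdash z=(x\dashv y)\vdash z$, such that there is at least one bar-unit (an element $\xi$ with $x\dashv\xi=x=\xi\vdash x$ for all $x$), and for every bar-unit $\xi$ and every $x\in D$ there are $x^{-1}_{r,\xi},x^{-1}_{l,\xi}\in D$ with $x\vdash x^{-1}_{r,\xi}=\xi$ and $x^{-1}_{l,\xi}\dashv x=\xi$. A digroup is a generalized digroup with a distinguished bar-unit $\xi$ such that every $x\in D$ admits a single inverse $x^{-1}$ satisfying $x\vdash x^{-1}=\xi=x^{-1}\dashv x$. Its conjugation rack $\mathrm{Conj}(D)$ is the set $D$ with $x\triangleright y=(x\vdash y)\dashv x^{-1}$; it is a rack, i.e. each left translation $y\mapsto x\triangleright y$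 is bijective and $x\triangleright(y\triangleright z)=(x\triangleright y)\triangleright(x\triangleright z)$. The digroup algebra of $D$ (not necessarily finite) is the free $K$-vector space $K[D]=\bigoplus_{x\in D}Kx$ with the bilinear extensions of $\vdash,\dashv$, the element $\xi$, and the linear maps determined by $\Delta(x)=x\otimes x$, $\varepsilon(x)=1$, $S(x)=x^{-1}$ for $x\in D$; it is a cocommutative Hopf dialgebra with antipode $S$. For a cocommutative Hopf dialgebra $A=(A,\Delta,\varepsilon,\xi,\vdash,\dashv,S)$, the adjoint rack bialgebra $\mathrm{Adj}(A)$ is the coalgebra $A$ with $\xi$ and the product $a\triangleright b:=\sum_{(a)}(a_{(1)}\vdash b)\dashv S(a_{(2)})$ (Sweedler notation $\Delta(a)=\sum_{(a)}a_{(1)}\otimes a_{(2)}$). The rack associated with $A$ by the adjoint construction is $\mathrm{Slike}(\mathrm{Adj}(A)):=\{b\in A\mid\Delta(b)=b\otimes b,\ \varepsilon(b)=1\}$ with the restriction of $\triangleright$. $\mathrm{Glike}(A)$ is the same set, viewed as a digroup with the restricted products $\vdash,\dashv$, distinguished bar-unit $\xi$ and inverse $g^{-1}=S(g)$; elements of $D$ are identified with the canonical basis of $K[D]$. *)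

theory Defs
  imports Complex_Main "HOL-Library.Poly_Mapping" "HOL-Algebra.Congruence"
begin

section \<open>Digroups and racks\<close>

record 'a digroup_data = "'a partial_object" +
  vdash :: "'a \<Rightarrow> 'a \<Rightarrow> 'a"  (infixl \<open>\<turnstile>\<index>\<close> 70)
  dashv :: "'a \<Rightarrow> 'a \<Rightarrow> 'a"  (infixl \<open>\<stileturn>\<index>\<close> 70)
  unit_elem :: 'a  (\<open>\<xi>\<index>\<close>)

definition bar_unit :: "('a, 'z) digroup_data_scheme \<Rightarrow> 'a \<Rightarrow> bool" where
  "bar_unit D u \<longleftrightarrow> u \<in> carrier D \<and> (\<forall>x\<in>carrier D. x \<stileturn>\<^bsub>D\<^esub> u = x \<and> u \<turnstile>\<^bsub>D\<^esub> x = x)"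

locale generalized_digroup =
  fixes D :: "('a, 'z) digroup_data_scheme" (structure)
  assumes vdash_closed: "\<lbrakk>x \<in> carrier D; y \<in> carrier D\<rbrakk> \<Longrightarrow> x \<turnstile> y \<in> carrier D"
    and dashv_closed: "\<lbrakk>x \<in> carrier D; y \<in> carrier D\<rbrakk> \<Longrightarrow> x \<stileturn> y \<in> carrier D"
    and vdash_assoc: "\<lbrakk>x \<in> carrier D; y \<in> carrier D; z \<in> carrier D\<rbrakk>
      \<Longrightarrow> (x \<turnstile> y) \<turnstile> z = x \<turnstile> (y \<turnstile> z)"
    and dashv_assoc: "\<lbrakk>x \<in> carrier D; y \<in> carrier D; z \<in> carrier D\<rbrakk>
      \<Longrightarrow> (x \<stileturn> y) \<stileturn> z = x \<stileturn> (y \<stileturn> z)"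
    and inner_assoc: "\<lbrakk>x \<in> carrier D; y \<in> carrier D; z \<in> carrier D\<rbrakk>
      \<Longrightarrow> x \<turnstile> (y \<stileturn> z) = (x \<turnstile> y) \<stileturn> z"
    and right_bar: "\<lbrakk>x \<in> carrier D; y \<in> carrier D; z \<in> carrier D\<rbrakk>
      \<Longrightarrow> x \<stileturn> (y \<stileturn> z) = x \<stileturn> (y \<turnstile> z)"
    and left_bar: "\<lbrakk>x \<in> carrier D; y \<in> carrier D; z \<in> carrier D\<rbrakk>
      \<Longrightarrow> (x \<turnstile> y) \<turnstile> z = (x \<stileturn> y) \<turnstile> z"
    and ex_bar_unit: "\<exists>u. bar_unit D u"
    and right_inverse: "\<lbrakk>bar_unit D u; x \<in> carrier D\<rbrakk> \<Longrightarrow> \<exists>y\<in>carrier D. x \<turnstile> y = u"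
    and left_inverse: "\<lbrakk>bar_unit D u; x \<in> carrier D\<rbrakk> \<Longrightarrow> \<exists>y\<in>carrier D. y \<stileturn> x = u"

locale digroup = generalized_digroup +
  assumes bar_unit_unit: "bar_unit D \<xi>"
    and single_inverse: "x \<in> carrier D \<Longrightarrow> \<exists>!y. y \<in> carrier D \<and> x \<turnstile> y = \<xi> \<and> y \<stileturn> x = \<xi>"

definition dinv :: "('a, 'z) digroup_data_scheme \<Rightarrow> 'a \<Rightarrow> 'a" where
  "dinv D x = (THE y. y \<in> carrier D \<and> x \<turnstile>\<^bsub>D\<^esub> y = \<xi>\<^bsub>D\<^esub> \<and> y \<stileturn>\<^bsub>D\<^esub> x = \<xi>\<^bsub>D\<^esub>)"

definition digroup_iso ::
    "('a \<Rightarrow> 'b) \<Rightarrow> ('a, 'y) digroup_data_scheme \<Rightarrow> ('b, 'z) digroup_data_scheme \<Rightarrow> bool" where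
  "digroup_iso f D E \<longleftrightarrow> bij_betw f (carrier D) (carrier E) \<and> f \<xi>\<^bsub>D\<^esub> = \<xi>\<^bsub>E\<^esub> \<and>
    (\<forall>x\<in>carrier D. \<forall>y\<in>carrier D.
       f (x \<turnstile>\<^bsub>D\<^esub> y) = f x \<turnstile>\<^bsub>E\<^esub> f y \<and> f (x \<stileturn>\<^bsub>D\<^esub> y) = f x \<stileturn>\<^bsub>E\<^esub> f y)"

record 'a rack_data = "'a partial_object" +
  rack_op :: "'a \<Rightarrow> 'a \<Rightarrow> 'a"  (infixl \<open>\<triangleright>\<index>\<close> 70)

locale rack =
  fixes R :: "('a, 'z) rack_data_scheme" (structure)
  assumes left_translation_bij: "x \<in> carrier R \<Longrightarrow> bij_betw (\<lambda>y. x \<triangleright> y) (carrier R) (carrier R)"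
    and self_distrib: "\<lbrakk>x \<in> carrier R; y \<in> carrier R; z \<in> carrier R\<rbrakk>
      \<Longrightarrow> x \<triangleright> (y \<triangleright> z) = (x \<triangleright> y) \<triangleright> (x \<triangleright> z)"

definition rack_iso ::
    "('a \<Rightarrow> 'b) \<Rightarrow> ('a, 'y) rack_data_scheme \<Rightarrow> ('b, 'z) rack_data_scheme \<Rightarrow> bool" where
  "rack_iso f R Q \<longleftrightarrow> bij_betw f (carrier R) (carrier Q) \<and>
    (\<forall>x\<in>carrier R. \<forall>y\<in>carrier R. f (x \<triangleright>\<^bsub>R\<^esub> y) = f x \<triangleright>\<^bsub>Q\<^esub> f y)"

text \<open>Operations on a derived structure are restricted to its carrier (with value
  \<^term>\<open>undefined\<close> elsewhere), so that equality of records is equality of structures.\<close>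

definition conj_rack :: "('a, 'z) digroup_data_scheme \<Rightarrow> 'a rack_data" where
  "conj_rack D = \<lparr>carrier = carrier D,
     rack_op = (\<lambda>x\<in>carrier D. \<lambda>y\<in>carrier D. (x \<turnstile>\<^bsub>D\<^esub> y) \<stileturn>\<^bsub>D\<^esub> dinv D x)\<rparr>"


section \<open>Free vector spaces and tensor squares\<close>

text \<open>The free vector space on a set \<open>X\<close> consists of the \<open>p :: 'a \<Rightarrow>\<^sub>0 'k\<close> with
  \<open>keys p \<subseteq> X\<close>.\<close>

definition free_scale :: "'k::field \<Rightarrow> ('a \<Rightarrow>\<^sub>0 'k) \<Rightarrow> ('a \<Rightarrow>\<^sub>0 'k)" where
  "free_scale c p = Poly_Mapping.map ((*) c) p"

lemma lookup_free_scale [simp]: "Poly_Mapping.lookup (free_scale c p) x = c * Poly_Mapping.lookup p x"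
  unfolding free_scale_def by transfer (simp add: when_def)

global_interpretation free: vector_space "free_scale :: 'k::field \<Rightarrow> ('a \<Rightarrow>\<^sub>0 'k) \<Rightarrow> ('a \<Rightarrow>\<^sub>0 'k)"
  by unfold_locales (auto intro!: poly_mapping_eqI simp: lookup_add algebra_simps)

definition basis :: "'a \<Rightarrow> ('a \<Rightarrow>\<^sub>0 'k::field)" where
  "basis x = Poly_Mapping.single x 1"

definition lin_ext :: "('k \<Rightarrow> 'w \<Rightarrow> 'w) \<Rightarrow> ('a \<Rightarrow> 'w) \<Rightarrow> ('a \<Rightarrow>\<^sub>0 'k::field) \<Rightarrow> 'w::ab_group_add" where
  "lin_ext sc f p = (\<Sum>x\<in>Poly_Mapping.keys p. sc (Poly_Mapping.lookup p x) (f x))"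

definition bilin_ext :: "('a \<Rightarrow> 'a \<Rightarrow> 'a) \<Rightarrow> ('a \<Rightarrow>\<^sub>0 'k::field) \<Rightarrow> ('a \<Rightarrow>\<^sub>0 'k) \<Rightarrow> ('a \<Rightarrow>\<^sub>0 'k)" where
  "bilin_ext m p q = lin_ext free_scale (\<lambda>x. lin_ext free_scale (\<lambda>y. basis (m x y)) q) p"

text \<open>For a vector space with carrier \<open>V\<close> and scalar multiplication \<open>sc\<close>, the space
  \<open>V \<otimes> V\<close> is the quotient of the free vector space on \<open>V \<times> V\<close> by the span of the
  bilinearity relations; tensors are represented as cosets of that span.\<close>

type_synonym ('k, 'v) tensor2 = "('v \<times> 'v \<Rightarrow>\<^sub>0 'k) set"

definition bilinearity_relations ::
    "('k::field \<Rightarrow> 'v \<Rightarrow> 'v::ab_group_add) \<Rightarrow> 'v set \<Rightarrow> ('v \<times> 'v \<Rightarrow>\<^sub>0 'k) set" where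
  "bilinearity_relations sc V =
     {basis (u + u', w) - basis (u, w) - basis (u', w) | u u' w. u \<in> V \<and> u' \<in> V \<and> w \<in> V} \<union>
     {basis (u, w + w') - basis (u, w) - basis (u, w') | u w w'. u \<in> V \<and> w \<in> V \<and> w' \<in> V} \<union>
     {basis (sc c u, w) - free_scale c (basis (u, w)) | c u w. u \<in> V \<and> w \<in> V} \<union>
     {basis (u, sc c w) - free_scale c (basis (u, w)) | c u w. u \<in> V \<and> w \<in> V}"

definition tensor_class ::
    "('k::field \<Rightarrow> 'v \<Rightarrow> 'v::ab_group_add) \<Rightarrow> 'v set \<Rightarrow> ('v \<times> 'v \<Rightarrow>\<^sub>0 'k) \<Rightarrow> ('k, 'v) tensor2" where
  "tensor_class sc V p = {q. q - p \<in> free.span (bilinearity_relations sc V)}"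

definition pure_tensor ::
    "('k::field \<Rightarrow> 'v \<Rightarrow> 'v::ab_group_add) \<Rightarrow> 'v set \<Rightarrow> 'v \<Rightarrow> 'v \<Rightarrow> ('k, 'v) tensor2" where
  "pure_tensor sc V u w = tensor_class sc V (basis (u, w))"

text \<open>The value at a tensor of the linear map induced by a bilinear \<open>f\<close>, i.e.\ the Sweedler sum
  of the \<open>f t\<^sub>(\<^sub>1\<^sub>) t\<^sub>(\<^sub>2\<^sub>)\<close>. For bilinear \<open>f\<close> all representatives of the coset give the same sum.\<close>

definition sweedler_sum ::
    "('k::field \<Rightarrow> 'v \<Rightarrow> 'v::ab_group_add) \<Rightarrow> ('v \<Rightarrow> 'v \<Rightarrow> 'v) \<Rightarrow> ('k, 'v) tensor2 \<Rightarrow> 'v" where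
  "sweedler_sum sc f t = (THE s. \<forall>p\<in>t. lin_ext sc (\<lambda>(u, w). f u w) p = s)"


section \<open>Hopf dialgebras and rack bialgebras\<close>

record (overloaded) ('k::zero, 'v) coalgebra_data = "'v partial_object" +
  scale :: "'k \<Rightarrow> 'v \<Rightarrow> 'v"
  comult :: "'v \<Rightarrow> ('k, 'v) tensor2"
  counit :: "'v \<Rightarrow> 'k"

record (overloaded) ('k::zero, 'v) hopf_dialgebra_data = "('k, 'v) coalgebra_data" +
  hopf_vdash :: "'v \<Rightarrow> 'v \<Rightarrow> 'v"  (infixl \<open>\<^bold>\<turnstile>\<index>\<close> 70)
  hopf_dashv :: "'v \<Rightarrow> 'v \<Rightarrow> 'v"  (infixl \<open>\<^bold>\<stileturn>\<index>\<close> 70)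
  hopf_unit :: 'v
  antipode :: "'v \<Rightarrow> 'v"

record (overloaded) ('k::zero, 'v) rack_bialgebra_data = "('k, 'v) coalgebra_data" +
  bialg_unit :: 'v
  bialg_op :: "'v \<Rightarrow> 'v \<Rightarrow> 'v"  (infixl \<open>\<^bold>\<triangleright>\<index>\<close> 70)

definition grouplikes ::
    "('k::field, 'v::ab_group_add, 'z) coalgebra_data_scheme \<Rightarrow> 'v set" where
  "grouplikes C = {b \<in> carrier C.
     comult C b = pure_tensor (scale C) (carrier C) b b \<and> counit C b = 1}"

definition Adj ::
    "('k::field, 'v::ab_group_add) hopf_dialgebra_data \<Rightarrow> ('k, 'v) rack_bialgebra_data" where
  "Adj A = \<lparr>carrier = carrier A, scale = scale A, comult = comult A, counit = counit A,
     bialg_unit = hopf_unit A,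
     bialg_op = (\<lambda>a\<in>carrier A. \<lambda>b\<in>carrier A.
       sweedler_sum (scale A) (\<lambda>a1 a2. (a1 \<^bold>\<turnstile>\<^bsub>A\<^esub> b) \<^bold>\<stileturn>\<^bsub>A\<^esub> antipode A a2) (comult A a))\<rparr>"

definition Slike ::
    "('k::field, 'v::ab_group_add) rack_bialgebra_data \<Rightarrow> 'v rack_data" where
  "Slike B = \<lparr>carrier = grouplikes B,
     rack_op = (\<lambda>a\<in>grouplikes B. \<lambda>b\<in>grouplikes B. a \<^bold>\<triangleright>\<^bsub>B\<^esub> b)\<rparr>"

definition Glike ::
    "('k::field, 'v::ab_group_add) hopf_dialgebra_data \<Rightarrow> 'v digroup_data" where
  "Glike A = \<lparr>carrier = grouplikes A,
     vdash = (\<lambda>a\<in>grouplikes A. \<lambda>b\<in>grouplikes A. a \<^bold>\<turnstile>\<^bsub>A\<^esub> b),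
     dashv = (\<lambda>a\<in>grouplikes A. \<lambda>b\<in>grouplikes A. a \<^bold>\<stileturn>\<^bsub>A\<^esub> b),
     unit_elem = hopf_unit A\<rparr>"

definition digroup_algebra ::
    "('d, 'z) digroup_data_scheme \<Rightarrow> ('k::field, 'd \<Rightarrow>\<^sub>0 'k) hopf_dialgebra_data" where
  "digroup_algebra D =
    (let V = {a. Poly_Mapping.keys a \<subseteq> carrier D} in
     \<lparr>carrier = V,
      scale = free_scale,
      comult = (\<lambda>a. tensor_class free_scale V
                  (lin_ext free_scale (\<lambda>x. basis (basis x, basis x)) a)),
      counit = lin_ext (*) (\<lambda>x. 1),
      hopf_vdash = bilin_ext (vdash D),
      hopf_dashv = bilin_ext (dashv D),
      hopf_unit = basis \<xi>\<^bsub>D\<^esub>,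
      antipode = lin_ext free_scale (\<lambda>x. basis (dinv D x))\<rparr>)"

end

theory Submission
  imports Defs
begin

text \<open>Evaluating \<open>\<Delta> a = a \<otimes> a\<close> under the bilinear forms \<open>(u, w) \<mapsto> u\<^sub>x w\<^sub>y\<close> gives
  \<open>a\<^sub>x a\<^sub>y = \<delta>\<^sub>x\<^sub>y a\<^sub>x\<close>, so together with \<open>\<epsilon> a = 1\<close> the group-like elements of \<open>K[D]\<close> are exactly
  the basis elements. Hence the basis map is an isomorphism from \<open>D\<close> onto \<open>Glike K[D]\<close>. The Sweedler
  sum of a group-like element has the single term \<open>a \<otimes> a\<close>, so the adjoint operation on
  group-likes is conjugation. Conjugation is a rack operation because \<open>\<turnstile>\<close> and \<open>\<stileturn>\<close> define a left
  and a right action in which \<open>x\<close> and \<open>x\<^sup>-\<^sup>1\<close> cancel.\<close>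

section \<open>The conjugation rack\<close>

context digroup
begin

lemma unit_closed [simp]: "\<xi> \<in> carrier D"
  and dashv_unit [simp]: "x \<in> carrier D \<Longrightarrow> x \<stileturn> \<xi> = x"
  and unit_vdash [simp]: "x \<in> carrier D \<Longrightarrow> \<xi> \<turnstile> x = x"
  using bar_unit_unit unfolding bar_unit_def by auto

lemma
  assumes "x \<in> carrier D"
  shows dinv_closed: "dinv D x \<in> carrier D"
    and vdash_dinv: "x \<turnstile> dinv D x = \<xi>"
    and dinv_dashv: "dinv D x \<stileturn> x = \<xi>"
  using theI'[OF single_inverse[OF assms]] unfolding dinv_def by auto

lemma dinv_unique:
  assumes "x \<in> carrier D" "y \<in> carrier D" "x \<turnstile> y = \<xi>" "y \<stileturn> x = \<xi>"
  shows "dinv D x = y"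
  unfolding dinv_def by (rule the1_equality[OF single_inverse[OF assms(1)]]) (simp add: assms)

lemmas closed = vdash_closed dashv_closed dinv_closed

text \<open>Only \<open>x \<turnstile> dinv D x\<close> and \<open>dinv D x \<stileturn> x\<close>
  are known to be \<open>\<xi>\<close>. To the right of \<open>z \<stileturn>\<close>,
  \<open>right_bar\<close> trades one product for the other, so both orders cancel.\<close>

lemma dashv_dinv_cancel:
  assumes "x \<in> carrier D" "z \<in> carrier D"
  shows "(z \<stileturn> x) \<stileturn> dinv D x = z" "(z \<stileturn> dinv D x) \<stileturn> x = z"
  using assms
  by (simp_all add: dashv_assoc closed right_bar[of z x "dinv D x"] vdash_dinv dinv_dashv)

lemma vdash_dinv_cancel:
  assumes "x \<in> carrier D" "z \<in> carrier D"
  shows "x \<turnstile> (dinv D x \<turnstile> z) = z" "dinv D x \<turnstile> (x \<turnstile> z) = z"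
proof -
  show "x \<turnstile> (dinv D x \<turnstile> z) = z"
    using assms by (simp add: vdash_assoc[symmetric] closed vdash_dinv)
  \<comment> \<open>The product \<open>dinv D x \<turnstile> x\<close> may differ from
    \<open>\<xi>\<close>; \<open>left_bar\<close> replaces it by
    \<open>dinv D x \<stileturn> x\<close>.\<close>
  have "dinv D x \<turnstile> (x \<turnstile> z) = (dinv D x \<stileturn> x) \<turnstile> z"
    using assms by (simp add: vdash_assoc[symmetric] closed left_bar)
  then show "dinv D x \<turnstile> (x \<turnstile> z) = z"
    using assms by (simp add: dinv_dashv)
qed

text \<open>A left action does not see which product formed the acting element
  (\<open>left_bar\<close>), so a conjugate acts as the composite of its three factors.\<close>

lemma conj_vdash:
  assumes "x \<in> carrier D" "y \<in> carrier D" "z \<in> carrier D"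
  shows "((x \<turnstile> y) \<stileturn> dinv D x) \<turnstile> z = x \<turnstile> (y \<turnstile> (dinv D x \<turnstile> z))"
proof -
  have "((x \<turnstile> y) \<stileturn> dinv D x) \<turnstile> z = ((x \<turnstile> y) \<turnstile> dinv D x) \<turnstile> z"
    using assms by (intro left_bar[symmetric]) (simp_all add: closed)
  then show ?thesis
    using assms by (simp add: vdash_assoc closed)
qed

text \<open>The mirror image for the right action, by \<open>right_bar\<close>.\<close>

lemma dashv_conj:
  assumes "x \<in> carrier D" "y \<in> carrier D" "z \<in> carrier D"
  shows "z \<stileturn> ((x \<turnstile> y) \<stileturn> dinv D x) = ((z \<stileturn> x) \<stileturn> y) \<stileturn> dinv D x"
  using assms by (simp add: dashv_assoc[of z, symmetric] right_bar[symmetric] closed)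

text \<open>This avoids a formula for the inverse of a conjugate: \<open>?w\<close> sends
  \<open>?r\<close> back to \<open>z\<close>, and the right action of \<open>?w\<close> can be
  cancelled.\<close>

lemma dashv_dinv_conj:
  assumes x: "x \<in> carrier D" and y: "y \<in> carrier D" and z: "z \<in> carrier D"
  shows "z \<stileturn> dinv D ((x \<turnstile> y) \<stileturn> dinv D x) = ((z \<stileturn> x) \<stileturn> dinv D y) \<stileturn> dinv D x"
    (is "z \<stileturn> dinv D ?w = ?r")
proof -
  have w: "?w \<in> carrier D" and r: "?r \<in> carrier D"
    using assms by (simp_all add: closed)
  have "?r \<stileturn> ?w = z"
    unfolding dashv_conj[OF x y r] using assms by (simp add: dashv_dinv_cancel closed)
  then show ?thesis
    using dashv_dinv_cancel(1)[OF w r] by simp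
qed

lemma rack_conj_rack: "rack (conj_rack D)"
proof
  fix x assume "x \<in> carrier (conj_rack D)"
  then have x: "x \<in> carrier D"
    by (simp add: conj_rack_def)
  show "bij_betw (\<lambda>y. x \<triangleright>\<^bsub>conj_rack D\<^esub> y) (carrier (conj_rack D)) (carrier (conj_rack D))"
    using x
    \<comment> \<open>The witness is conjugation by the inverse, with \<open>x\<close> on the right
      instead of \<open>dinv D (dinv D x)\<close>, which need not equal \<open>x\<close>.\<close>
    by (intro bij_betw_byWitness[where f' = "\<lambda>y. (dinv D x \<turnstile> y) \<stileturn> x"])
      (auto simp: conj_rack_def closed inner_assoc vdash_dinv_cancel dashv_dinv_cancel)
next
  fix x y z
  assume "x \<in> carrier (conj_rack D)" "y \<in> carrier (conj_rack D)" "z \<in> carrier (conj_rack D)"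
  then have c: "x \<in> carrier D" "y \<in> carrier D" "z \<in> carrier D"
    by (simp_all add: conj_rack_def)
  then show "x \<triangleright>\<^bsub>conj_rack D\<^esub> (y \<triangleright>\<^bsub>conj_rack D\<^esub> z) =
    (x \<triangleright>\<^bsub>conj_rack D\<^esub> y) \<triangleright>\<^bsub>conj_rack D\<^esub> (x \<triangleright>\<^bsub>conj_rack D\<^esub> z)"
    \<comment> \<open>Both sides become \<open>x \<turnstile> (y \<turnstile> z)\<close> followed by
      the right actions of \<open>dinv D y\<close> and \<open>dinv D x\<close>.\<close>
    by (simp add: conj_rack_def closed dashv_dinv_conj conj_vdash inner_assoc
        vdash_dinv_cancel dashv_dinv_cancel)
qed

end

section \<open>Transport along bijections\<close>

text \<open>Since \<open>f\<close> preserves products and unit, the image of \<open>dinv D x\<close>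
  solves both inverse equations in \<open>E\<close>, where the solution is unique.\<close>

lemma digroup_iso_dinv:
  assumes "digroup D" "digroup E" "digroup_iso f D E" "x \<in> carrier D"
  shows "dinv E (f x) = f (dinv D x)"
proof -
  interpret D: digroup D by fact
  interpret E: digroup E by fact
  have c: "f y \<in> carrier E" if "y \<in> carrier D" for y
    using assms(3) that unfolding digroup_iso_def bij_betw_def by blast
  have h: "f x \<turnstile>\<^bsub>E\<^esub> f y = f (x \<turnstile>\<^bsub>D\<^esub> y)" "f x \<stileturn>\<^bsub>E\<^esub> f y = f (x \<stileturn>\<^bsub>D\<^esub> y)" "\<xi>\<^bsub>E\<^esub> = f \<xi>\<^bsub>D\<^esub>"
    if "x \<in> carrier D" "y \<in> carrier D" for x y
    using assms(3) that unfolding digroup_iso_def by auto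
  show ?thesis
    using assms(4)
    \<comment> \<open>The equation \<open>h(3)\<close> does not mention \<open>x\<close> and
      \<open>y\<close>, so they are instantiated by hand to discharge its premises.\<close>
    by (intro E.dinv_unique) (simp_all add: c h D.dinv_closed D.vdash_dinv D.dinv_dashv h(3)[of x x])
qed

lemma rack_iso_conj_rack:
  assumes "digroup D" "digroup E" "digroup_iso f D E"
  shows "rack_iso f (conj_rack D) (conj_rack E)"
proof -
  interpret D: digroup D by fact
  have c: "f y \<in> carrier E" if "y \<in> carrier D" for y
    using assms(3) that unfolding digroup_iso_def bij_betw_def by blast
  have h: "f (x \<turnstile>\<^bsub>D\<^esub> y) = f x \<turnstile>\<^bsub>E\<^esub> f y" "f (x \<stileturn>\<^bsub>D\<^esub> y) = f x \<stileturn>\<^bsub>E\<^esub> f y"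
    if "x \<in> carrier D" "y \<in> carrier D" for x y
    using assms(3) that unfolding digroup_iso_def by auto
  show ?thesis
    using assms(3)
    by (auto simp: rack_iso_def conj_rack_def digroup_iso_def h c D.closed
        digroup_iso_dinv[OF assms])
qed

text \<open>Every element of \<open>E\<close> is an image under \<open>f\<close>, so each axiom
  pulls back to \<open>D\<close>. This gives \<open>Glike\<close> its digroup structure without a
  check of dialgebra axioms.\<close>

lemma digroup_iso_digroup:
  assumes "digroup D" "digroup_iso f D E"
  shows "digroup E"
proof -
  interpret D: digroup D by fact
  have inj: "inj_on f (carrier D)" and E: "carrier E = f ` carrier D" and u: "\<xi>\<^bsub>E\<^esub> = f \<xi>\<^bsub>D\<^esub>"
    using assms(2) unfolding digroup_iso_def bij_betw_def by auto
  have h: "f x \<turnstile>\<^bsub>E\<^esub> f y = f (x \<turnstile>\<^bsub>D\<^esub> y)" "f x \<stileturn>\<^bsub>E\<^esub> f y = f (x \<stileturn>\<^bsub>D\<^esub> y)"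
    if "x \<in> carrier D" "y \<in> carrier D" for x y
    using assms(2) that unfolding digroup_iso_def by auto
  have eq: "f x = f y \<longleftrightarrow> x = y" if "x \<in> carrier D" "y \<in> carrier D" for x y
    using inj that by (simp add: inj_on_eq_iff)
  have bar: "bar_unit E (f v) \<longleftrightarrow> bar_unit D v" if "v \<in> carrier D" for v
    using that by (auto simp: bar_unit_def E h eq D.closed)
  \<comment> \<open>Inverses are required for every bar-unit of \<open>E\<close>, so each of them
    must be traced back to a bar-unit of \<open>D\<close>.\<close>
  have barE: "\<exists>v. w = f v \<and> v \<in> carrier D \<and> bar_unit D v" if "bar_unit E w" for w
  proof -
    from that have "w \<in> f ` carrier D" by (simp add: bar_unit_def E)
    with that bar show ?thesis by auto
  qed
  show ?thesis
  proof
    show "x \<turnstile>\<^bsub>E\<^esub> y \<in> carrier E" "x \<stileturn>\<^bsub>E\<^esub> y \<in> carrier E"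
      if "x \<in> carrier E" "y \<in> carrier E" for x y
      using that by (auto simp: E h D.closed)
    show "(x \<turnstile>\<^bsub>E\<^esub> y) \<turnstile>\<^bsub>E\<^esub> z = x \<turnstile>\<^bsub>E\<^esub> (y \<turnstile>\<^bsub>E\<^esub> z)"
      "(x \<stileturn>\<^bsub>E\<^esub> y) \<stileturn>\<^bsub>E\<^esub> z = x \<stileturn>\<^bsub>E\<^esub> (y \<stileturn>\<^bsub>E\<^esub> z)"
      "x \<turnstile>\<^bsub>E\<^esub> (y \<stileturn>\<^bsub>E\<^esub> z) = (x \<turnstile>\<^bsub>E\<^esub> y) \<stileturn>\<^bsub>E\<^esub> z"
      if "x \<in> carrier E" "y \<in> carrier E" "z \<in> carrier E" for x y z
      using that by (auto simp: E h D.closed D.vdash_assoc D.dashv_assoc D.inner_assoc)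
    show "x \<stileturn>\<^bsub>E\<^esub> (y \<stileturn>\<^bsub>E\<^esub> z) = x \<stileturn>\<^bsub>E\<^esub> (y \<turnstile>\<^bsub>E\<^esub> z)"
      "(x \<turnstile>\<^bsub>E\<^esub> y) \<turnstile>\<^bsub>E\<^esub> z = (x \<stileturn>\<^bsub>E\<^esub> y) \<turnstile>\<^bsub>E\<^esub> z"
      if "x \<in> carrier E" "y \<in> carrier E" "z \<in> carrier E" for x y z
      using that by (auto simp: E h D.closed D.right_bar D.left_bar)
    show "\<exists>u. bar_unit E u"
      using bar[OF D.unit_closed] D.bar_unit_unit by blast
    show "\<exists>y\<in>carrier E. x \<turnstile>\<^bsub>E\<^esub> y = w" "\<exists>y\<in>carrier E. y \<stileturn>\<^bsub>E\<^esub> x = w"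
      if "bar_unit E w" "x \<in> carrier E" for w x
      using barE[OF that(1)] that(2) D.right_inverse D.left_inverse
      by (auto simp: E h eq D.closed)
    show "bar_unit E \<xi>\<^bsub>E\<^esub>"
      using bar[OF D.unit_closed] D.bar_unit_unit u by simp
    show "\<exists>!y. y \<in> carrier E \<and> x \<turnstile>\<^bsub>E\<^esub> y = \<xi>\<^bsub>E\<^esub> \<and> y \<stileturn>\<^bsub>E\<^esub> x = \<xi>\<^bsub>E\<^esub>"
      if "x \<in> carrier E" for x
    proof -
      from that obtain x' where x': "x' \<in> carrier D" "x = f x'" by (auto simp: E)
      show ?thesis
      proof (rule ex1I[of _ "f (dinv D x')"])
        show "f (dinv D x') \<in> carrier E \<and> x \<turnstile>\<^bsub>E\<^esub> f (dinv D x') = \<xi>\<^bsub>E\<^esub> \<and>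
          f (dinv D x') \<stileturn>\<^bsub>E\<^esub> x = \<xi>\<^bsub>E\<^esub>"
          using x' by (simp add: E u h D.closed D.vdash_dinv D.dinv_dashv)
      next
        fix y assume "y \<in> carrier E \<and> x \<turnstile>\<^bsub>E\<^esub> y = \<xi>\<^bsub>E\<^esub> \<and> y \<stileturn>\<^bsub>E\<^esub> x = \<xi>\<^bsub>E\<^esub>"
        then show "y = f (dinv D x')"
          using x' D.dinv_unique[of x'] by (auto simp: E u h eq D.closed)
      qed
    qed
  qed
qed

section \<open>Linear extensions and tensors\<close>

lemma lookup_basis: "Poly_Mapping.lookup (basis x) y = (if x = y then 1 else 0)"
  by (simp add: basis_def lookup_single when_def)

lemma keys_basis [simp]: "Poly_Mapping.keys (basis x :: 'a \<Rightarrow>\<^sub>0 'k::field) = {x}"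
  by (simp add: basis_def)

lemma inj_basis: "inj (basis :: 'a \<Rightarrow> 'a \<Rightarrow>\<^sub>0 'k::field)"
  by (metis injI keys_basis singleton_inject)

lemma vector_space_field: "vector_space ((*) :: 'k::field \<Rightarrow> 'k \<Rightarrow> 'k)"
  by unfold_locales (simp_all add: algebra_simps)

lemma linear_lookup_mult:
  "Vector_Spaces.linear free_scale (*) (\<lambda>u. Poly_Mapping.lookup u x * (c :: 'k::field))"
  unfolding Vector_Spaces.linear_iff
  by (intro conjI allI free.vector_space_axioms vector_space_field)
    (simp_all add: lookup_add distrib_right)

lemma linear_mult_lookup:
  "Vector_Spaces.linear free_scale (*) (\<lambda>u. (c :: 'k::field) * Poly_Mapping.lookup u x)"
  unfolding mult.commute[of c] by (rule linear_lookup_mult)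

context vector_space
begin

text \<open>The supports of \<open>p\<close>, \<open>q\<close> and \<open>p + q\<close> differ;
  summing over a common finite set makes the sums comparable.\<close>

lemma lin_ext_superset:
  assumes "finite X" "Poly_Mapping.keys p \<subseteq> X"
  shows "lin_ext scale f p = (\<Sum>x\<in>X. scale (Poly_Mapping.lookup p x) (f x))"
  unfolding lin_ext_def using assms
  by (intro sum.mono_neutral_left) (auto simp: in_keys_iff)

lemma lin_ext_basis [simp]: "lin_ext scale f (basis x) = f x"
  by (simp add: lin_ext_def lookup_basis)

lemma linear_lin_ext: "Vector_Spaces.linear free_scale scale (lin_ext scale f)"
proof -
  have "lin_ext scale f (p + q) = lin_ext scale f p + lin_ext scale f q" for p q
  proof -
    let ?X = "Poly_Mapping.keys p \<union> Poly_Mapping.keys q"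
    have "lin_ext scale f (p + q) = (\<Sum>x\<in>?X. scale (Poly_Mapping.lookup (p + q) x) (f x))"
      using Poly_Mapping.keys_add[of p q] by (intro lin_ext_superset) auto
    also have "\<dots> = lin_ext scale f p + lin_ext scale f q"
      by (simp add: lin_ext_superset[of ?X] lookup_add scale_left_distrib sum.distrib)
    finally show ?thesis .
  qed
  moreover have "lin_ext scale f (free_scale c p) = scale c (lin_ext scale f p)" for c p
  proof -
    have "lin_ext scale f (free_scale c p) =
        (\<Sum>x\<in>Poly_Mapping.keys p. scale (Poly_Mapping.lookup (free_scale c p) x) (f x))"
      by (intro lin_ext_superset) (auto simp: in_keys_iff)
    then show ?thesis
      by (simp add: lin_ext_def scale_sum_right)
  qed
  ultimately show ?thesis
    by unfold_locales auto
qed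

end

text \<open>The first argument feeds the outer \<open>lin_ext\<close> directly; for the second,
  linearity of the inner one is carried through the sum over the keys of \<open>p\<close>.\<close>

lemma linear_bilin_ext:
  fixes m :: "'a \<Rightarrow> 'a \<Rightarrow> 'a"
  shows "Vector_Spaces.linear free_scale free_scale (\<lambda>p. bilin_ext m p (q :: 'a \<Rightarrow>\<^sub>0 'k::field))"
    and "Vector_Spaces.linear free_scale free_scale (bilin_ext m (p :: 'a \<Rightarrow>\<^sub>0 'k))"
proof -
  show "Vector_Spaces.linear free_scale free_scale (\<lambda>p. bilin_ext m p q)"
    unfolding bilin_ext_def by (rule free.linear_lin_ext)
  interpret l: Vector_Spaces.linear free_scale free_scale
    "lin_ext free_scale (f :: 'a \<Rightarrow> 'a \<Rightarrow>\<^sub>0 'k)" for f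
    by (rule free.linear_lin_ext)
  have "bilin_ext m p (q + r) = bilin_ext m p q + bilin_ext m p r" for q r
    unfolding bilin_ext_def l.add
    by (simp add: lin_ext_def free.scale_right_distrib sum.distrib)
  moreover have "bilin_ext m p (free_scale c q) = free_scale c (bilin_ext m p q)" for c q
    unfolding bilin_ext_def l.scale
    by (simp add: lin_ext_def free.scale_sum_right mult.left_commute)
  ultimately show "Vector_Spaces.linear free_scale free_scale (bilin_ext m p)"
    by unfold_locales auto
qed

lemma bilin_ext_basis [simp]:
  "bilin_ext m (basis x) (basis y) = (basis (m x y) :: 'a \<Rightarrow>\<^sub>0 'k::field)"
  by (simp add: bilin_ext_def)

lemma tensor_class_refl: "p \<in> tensor_class sc V p"
  by (simp add: tensor_class_def free.span_zero)

text \<open>The universal property of the tensor square: a bilinear \<open>f\<close> kills all four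
  kinds of relations, hence their span. The target is kept general to cover both scalar forms and
  Sweedler sums.\<close>

lemma lin_ext_tensor_class:
  fixes sc :: "'k::field \<Rightarrow> 'v \<Rightarrow> 'v::ab_group_add"
    and sc' :: "'k \<Rightarrow> 'w \<Rightarrow> 'w::ab_group_add"
  assumes l1: "\<And>w. Vector_Spaces.linear sc sc' (\<lambda>u. f u w)"
    and l2: "\<And>u. Vector_Spaces.linear sc sc' (f u)"
    and q: "q \<in> tensor_class sc V p"
  shows "lin_ext sc' (\<lambda>(u, w). f u w) q = lin_ext sc' (\<lambda>(u, w). f u w) p"
proof -
  interpret a: Vector_Spaces.linear sc sc' "\<lambda>u. f u w" for w by (rule l1)
  interpret b: Vector_Spaces.linear sc sc' "f u" for u by (rule l2)
  interpret l: Vector_Spaces.linear free_scale sc' "lin_ext sc' (\<lambda>(u, w). f u w)"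
    by (rule a.vs2.linear_lin_ext)
  have "lin_ext sc' (\<lambda>(u, w). f u w) r = 0" if "r \<in> bilinearity_relations sc V" for r
    using that unfolding bilinearity_relations_def
    by (auto simp: l.diff l.scale a.add b.add a.scale b.scale)
  moreover have "q - p \<in> free.span (bilinearity_relations sc V)"
    using q by (simp add: tensor_class_def)
  ultimately have "lin_ext sc' (\<lambda>(u, w). f u w) (q - p) = 0"
    by (rule l.eq_0_on_span)
  then show ?thesis
    by (simp add: l.diff)
qed

text \<open>The definite description is legitimate: the value is constant on the coset, and the
  coset contains \<open>p\<close>, which fixes it.\<close>

lemma sweedler_sum_tensor_class:
  assumes "\<And>w. Vector_Spaces.linear sc sc (\<lambda>u. f u w)" "\<And>u. Vector_Spaces.linear sc sc (f u)"
  shows "sweedler_sum sc f (tensor_class sc V p) = lin_ext sc (\<lambda>(u, w). f u w) p"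
  unfolding sweedler_sum_def
proof (rule the_equality)
  show "\<forall>q\<in>tensor_class sc V p. lin_ext sc (\<lambda>(u, w). f u w) q = lin_ext sc (\<lambda>(u, w). f u w) p"
    using lin_ext_tensor_class[where f = f, OF assms] by blast
qed (use tensor_class_refl[of p sc V] in auto)

section \<open>The digroup algebra\<close>

lemma digroup_algebra_sel:
  "carrier (digroup_algebra D) = {a. Poly_Mapping.keys a \<subseteq> carrier D}"
  "scale (digroup_algebra D) = free_scale"
  "comult (digroup_algebra D) a = tensor_class free_scale {a. Poly_Mapping.keys a \<subseteq> carrier D}
     (lin_ext free_scale (\<lambda>x. basis (basis x, basis x)) a)"
  "counit (digroup_algebra D) = lin_ext (*) (\<lambda>x. 1)"
  "hopf_vdash (digroup_algebra D) = bilin_ext (vdash D)"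
  "hopf_dashv (digroup_algebra D) = bilin_ext (dashv D)"
  "hopf_unit (digroup_algebra D) = basis \<xi>\<^bsub>D\<^esub>"
  "antipode (digroup_algebra D) = lin_ext free_scale (\<lambda>x. basis (dinv D x))"
  by (simp_all add: digroup_algebra_def Let_def)

lemma antipode_basis: "antipode (digroup_algebra D) (basis x) = basis (dinv D x)"
  by (simp add: digroup_algebra_sel)

lemma grouplikes_digroup_algebra:
  "grouplikes (digroup_algebra D :: ('k::field, 'd \<Rightarrow>\<^sub>0 'k) hopf_dialgebra_data) = basis ` carrier D"
    (is "grouplikes ?A = _")
proof
  interpret k: vector_space "(*) :: 'k \<Rightarrow> 'k \<Rightarrow> 'k" by (rule vector_space_field)
  show "basis ` carrier D \<subseteq> grouplikes ?A"
    by (auto simp: grouplikes_def digroup_algebra_sel pure_tensor_def)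
  show "grouplikes ?A \<subseteq> basis ` carrier D"
  proof
    fix a assume "a \<in> grouplikes ?A"
    then have keys: "Poly_Mapping.keys a \<subseteq> carrier D"
      and eps: "(\<Sum>x\<in>Poly_Mapping.keys a. Poly_Mapping.lookup a x) = 1"
      and Delta: "tensor_class free_scale (carrier ?A)
          (lin_ext free_scale (\<lambda>x. basis (basis x, basis x)) a) =
        tensor_class free_scale (carrier ?A) (basis (a, a))"
      by (auto simp: grouplikes_def digroup_algebra_sel pure_tensor_def lin_ext_def[of "(*)"])
    \<comment> \<open>The coefficients of \<open>a\<close> are orthogonal idempotents of the
      field.\<close>
    have prod: "Poly_Mapping.lookup a x * Poly_Mapping.lookup a y =
        (if x = y then Poly_Mapping.lookup a x else 0)" for x y
    proof -
      define f :: "('d \<Rightarrow>\<^sub>0 'k) \<Rightarrow> ('d \<Rightarrow>\<^sub>0 'k) \<Rightarrow> 'k"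
        where "f u w = Poly_Mapping.lookup u x * Poly_Mapping.lookup w y" for u w
      let ?F = "lin_ext (*) (\<lambda>(u, w). f u w)"
      have lin: "Vector_Spaces.linear free_scale (*) (\<lambda>u. f u w)"
        "Vector_Spaces.linear free_scale (*) (f w)" for w
        unfolding f_def by (rule linear_lookup_mult linear_mult_lookup)+
      interpret F: Vector_Spaces.linear free_scale "(*)" ?F
        by (rule k.linear_lin_ext)
      have "?F (lin_ext free_scale (\<lambda>x. basis (basis x, basis x)) a) = ?F (basis (a, a))"
        \<comment> \<open>By \<open>Delta\<close> the two arguments of \<open>?F\<close> lie in one
          coset, on which \<open>?F\<close> is constant.\<close>
        using lin_ext_tensor_class[OF lin, of _ "carrier ?A" "basis (a, a)"]
        unfolding Delta[symmetric] by (simp add: tensor_class_refl)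
      moreover have "?F (basis (a, a)) = Poly_Mapping.lookup a x * Poly_Mapping.lookup a y"
        by (simp add: f_def)
      moreover have "?F (lin_ext free_scale (\<lambda>x. basis (basis x, basis x)) a) =
          (\<Sum>z\<in>Poly_Mapping.keys a. Poly_Mapping.lookup a z * f (basis z) (basis z))"
        by (simp add: lin_ext_def[of free_scale] F.sum F.scale)
      \<comment> \<open>The form reads off the coordinate at \<open>(x, y)\<close>, so the term for
        \<open>z\<close> survives only if \<open>z = x\<close> and \<open>z = y\<close>.\<close>
      moreover have "\<dots> = (\<Sum>z\<in>Poly_Mapping.keys a.
          if z = x then if x = y then Poly_Mapping.lookup a x else 0 else 0)"
        by (intro sum.cong) (auto simp: f_def lookup_basis)
      moreover have "\<dots> = (if x = y then Poly_Mapping.lookup a x else 0)"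
        by (auto simp: in_keys_iff)
      ultimately show ?thesis by simp
    qed
    \<comment> \<open>The coefficients sum to 1, so the support is nonempty.\<close>
    obtain x where x: "x \<in> Poly_Mapping.keys a"
      using eps by fastforce
    then have ax: "Poly_Mapping.lookup a x = 1"
      using prod[of x x] by (simp add: in_keys_iff)
    have "a = basis x"
    proof (rule poly_mapping_eqI)
      \<comment> \<open>With coefficient 1 at \<open>x\<close>, \<open>prod\<close> forces the
        coefficient at every other \<open>y\<close> to vanish.\<close>
      show "Poly_Mapping.lookup a y = Poly_Mapping.lookup (basis x) y" for y
        using prod[of x y] unfolding ax lookup_basis by simp
    qed
    then show "a \<in> basis ` carrier D"
      using x keys by auto
  qed
qed

text \<open>Only the coproduct of the left factor enters, so \<open>b\<close> ranges over the whole
  algebra.\<close>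

lemma Adj_op_grouplike:
  fixes D :: "('d, 'z) digroup_data_scheme"
  defines "A \<equiv> digroup_algebra D :: ('k::field, 'd \<Rightarrow>\<^sub>0 'k) hopf_dialgebra_data"
  assumes a: "a \<in> grouplikes A" and b: "b \<in> carrier A"
  shows "a \<^bold>\<triangleright>\<^bsub>Adj A\<^esub> b = (a \<^bold>\<turnstile>\<^bsub>A\<^esub> b) \<^bold>\<stileturn>\<^bsub>A\<^esub> antipode A a"
proof -
  define f where "f u w = (u \<^bold>\<turnstile>\<^bsub>A\<^esub> b) \<^bold>\<stileturn>\<^bsub>A\<^esub> antipode A w" for u w
  have lin: "Vector_Spaces.linear free_scale free_scale (\<lambda>u. f u w)"
    "Vector_Spaces.linear free_scale free_scale (f u)" for u w
    \<comment> \<open>In \<open>u\<close> the map is two products with fixed right factors; in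
      \<open>w\<close> it is the antipode followed by a product with a fixed left factor.\<close>
    using Vector_Spaces.linear_compose[OF linear_bilin_ext(1) linear_bilin_ext(1)]
      Vector_Spaces.linear_compose[OF free.linear_lin_ext linear_bilin_ext(2)]
    unfolding f_def A_def digroup_algebra_sel comp_def by blast+
  have "a \<in> carrier A" and "comult A a = tensor_class free_scale (carrier A) (basis (a, a))"
    using a by (simp_all add: grouplikes_def pure_tensor_def A_def digroup_algebra_sel(2))
  then show ?thesis
    using b sweedler_sum_tensor_class[OF lin, of "carrier A" "basis (a, a)"]
    by (simp add: Adj_def f_def[abs_def] A_def digroup_algebra_sel(2))
qed

text \<open>This is the identification of \<open>D\<close> with the canonical basis: on basis
  elements the bilinear products are those of \<open>D\<close>.\<close>

lemma digroup_iso_Glike: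
  fixes D :: "'d digroup_data"
  shows "digroup_iso basis D (Glike (digroup_algebra D :: ('k::field, 'd \<Rightarrow>\<^sub>0 'k) hopf_dialgebra_data))"
proof -
  have inj: "inj_on (basis :: 'd \<Rightarrow> 'd \<Rightarrow>\<^sub>0 'k) (carrier D)"
    using inj_basis by (rule inj_on_subset) simp
  show ?thesis
    unfolding digroup_iso_def Glike_def grouplikes_digroup_algebra bij_betw_def
    by (simp add: inj digroup_algebra_sel(5-7))
qed

theorem theorem5p12:
  fixes D :: "'d digroup_data"
    and A :: "('k::field_char_0, 'd \<Rightarrow>\<^sub>0 'k) hopf_dialgebra_data"
  assumes "digroup D"
    and "A = digroup_algebra D"
  shows
    "rack (conj_rack D) \<and> rack (Slike (Adj A)) \<and>
     rack_iso basis (conj_rack D) (Slike (Adj A)) \<and>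
     (\<forall>x\<in>carrier D. \<forall>y\<in>carrier D.
        basis x \<^bold>\<triangleright>\<^bsub>Adj A\<^esub> basis y =
          sweedler_sum (scale A)
            (\<lambda>x1 x2. (x1 \<^bold>\<turnstile>\<^bsub>A\<^esub> basis y) \<^bold>\<stileturn>\<^bsub>A\<^esub> antipode A x2) (comult A (basis x)) \<and>
        basis x \<^bold>\<triangleright>\<^bsub>Adj A\<^esub> basis y = basis ((x \<turnstile>\<^bsub>D\<^esub> y) \<stileturn>\<^bsub>D\<^esub> dinv D x)) \<and>
     digroup (Glike A) \<and>
     (\<forall>g\<in>carrier (Glike A). dinv (Glike A) g = antipode A g) \<and>
     digroup_iso basis D (Glike A) \<and>
     Slike (Adj A) = conj_rack (Glike A) \<and>
     rack_iso basis (conj_rack D) (conj_rack (Glike A))"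
proof -
  interpret D: digroup D by fact
  have G: "grouplikes A = basis ` carrier D"
    unfolding assms(2) by (rule grouplikes_digroup_algebra)
  \<comment> \<open>The adjoint construction keeps the underlying coalgebra.\<close>
  have GA: "grouplikes (Adj A) = grouplikes A"
    by (simp add: grouplikes_def Adj_def)
  have iso: "digroup_iso basis D (Glike A)"
    unfolding assms(2) by (rule digroup_iso_Glike)
  have Glike: "digroup (Glike A)"
    by (rule digroup_iso_digroup[OF assms(1) iso])
  have dinv: "dinv (Glike A) g = antipode A g" if "g \<in> grouplikes A" for g
    using that digroup_iso_dinv[OF assms(1) Glike iso] G assms(2) by (auto simp: antipode_basis)
  have op: "a \<^bold>\<triangleright>\<^bsub>Adj A\<^esub> b = (a \<^bold>\<turnstile>\<^bsub>A\<^esub> b) \<^bold>\<stileturn>\<^bsub>A\<^esub> antipode A a"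
    if "a \<in> grouplikes A" "b \<in> grouplikes A" for a b
    using that Adj_op_grouplike[of a D b] assms(2) by (simp add: grouplikes_def)
  \<comment> \<open>The operations of \<open>Glike\<close> are restricted to group-likes, so
    intermediate results must be shown to stay there.\<close>
  have closed: "a \<^bold>\<turnstile>\<^bsub>A\<^esub> b \<in> grouplikes A" "antipode A a \<in> grouplikes A"
    if "a \<in> grouplikes A" "b \<in> grouplikes A" for a b
    using that unfolding G
    by (auto simp: assms(2) antipode_basis digroup_algebra_sel(5) D.closed)
  have Slike: "Slike (Adj A) = conj_rack (Glike A)"
  proof -
    have carrier: "carrier (Glike A) = grouplikes A"
      by (simp add: Glike_def)
    have "a \<^bold>\<triangleright>\<^bsub>Adj A\<^esub> b = (a \<turnstile>\<^bsub>Glike A\<^esub> b) \<stileturn>\<^bsub>Glike A\<^esub> dinv (Glike A) a"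
      if "a \<in> grouplikes A" "b \<in> grouplikes A" for a b
      \<comment> \<open>Inverses are replaced by the antipode first, while
        \<open>dinv (Glike A)\<close> is still in folded form.\<close>
      using that by (simp add: op dinv closed) (simp add: Glike_def closed)
    then show ?thesis
      \<comment> \<open>Both operations are restricted to the group-likes, so agreement there yields
        equality of records.\<close>
      unfolding Slike_def conj_rack_def GA carrier by (simp cong: restrict_cong)
  qed
  have basis_op: "basis x \<^bold>\<triangleright>\<^bsub>Adj A\<^esub> basis y = basis ((x \<turnstile>\<^bsub>D\<^esub> y) \<stileturn>\<^bsub>D\<^esub> dinv D x)"
    if "x \<in> carrier D" "y \<in> carrier D" for x y
    using that op[of "basis x" "basis y"] G
    by (simp add: assms(2) antipode_basis digroup_algebra_sel(5,6))
  have unfold_op: "basis x \<^bold>\<triangleright>\<^bsub>Adj A\<^esub> basis y = sweedler_sum (scale A)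
      (\<lambda>x1 x2. (x1 \<^bold>\<turnstile>\<^bsub>A\<^esub> basis y) \<^bold>\<stileturn>\<^bsub>A\<^esub> antipode A x2) (comult A (basis x))"
    if "x \<in> carrier D" "y \<in> carrier D" for x y
    using that by (simp add: Adj_def assms(2) digroup_algebra_sel(1))
  have riso: "rack_iso basis (conj_rack D) (conj_rack (Glike A))"
    by (rule rack_iso_conj_rack[OF assms(1) Glike iso])
  show ?thesis
    \<comment> \<open>The rack axioms for \<open>Slike (Adj A)\<close> come from its equality with
      the conjugation rack of \<open>Glike A\<close>.\<close>
    using D.rack_conj_rack digroup.rack_conj_rack[OF Glike] riso iso Glike dinv basis_op unfold_op
    by (simp add: Slike) (simp add: Glike_def)
qed

end
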